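(* Let $q\ge 3$ be an integer and let $N_q(n)$ denote the smallest number of rows $k$ for which a $3$-covering array with $k$ rows and $n$ columns over the alphabet $\{0,1,\ldots,q-1\}$ exists. Define $$A=\frac{(q+1)-\sqrt{(q+1)^2-4}}{2},$$ $$D=\frac{(q-1)^{3(q-1)}\,(q-A)^{q-A}}{q^{2q}\,A^{A}\,(1-A)^{2(1-A)}\,(q-2+A)^{q-2+A}\,(q-1-A)^{q-1-A}},$$ and $B(q)=\dfrac{2q}{\lg(1/D)}$. Then, as $n\to\infty$, $$N_q(n)\le B(q)\,\lg(n)\,(1+o(1)).$$
   Context: For integers $q\ge 2$ and $t\ge 1$, a $t$-covering array with entries from the alphabet $\mathcal{Q}=\{0,1,\ldots,q-1\}$ is a $k\times n$ array ($k$ rows, $n$ columns) with entries in $\mathcal{Q}$ such that for every choice of $t$ distinct columns, each of the $q^t$ words of length $t$ over $\mathcal{Q}$ appears at least once among the rows restricted to the selected columns. Here $\lg=\log_2$. *)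

theory Defs
  imports Complex_Main "HOL-Library.Landau_Symbols"
begin

text \<open>
  A \<open>k \<times> n\<close> array is a function \<open>M\<close> with entry \<open>M i j\<close> in row \<open>i < k\<close> and column \<open>j < n\<close>;
  values outside this range are irrelevant. A choice of columns is a list \<open>cs\<close> of distinct
  column indices, so that the row restricted to these columns is the word \<open>map (M i) cs\<close>.
\<close>

definition covering_array :: "nat \<Rightarrow> nat \<Rightarrow> nat \<Rightarrow> nat \<Rightarrow> (nat \<Rightarrow> nat \<Rightarrow> nat) \<Rightarrow> bool" where
  "covering_array t q k n M \<longleftrightarrow>
     (\<forall>i<k. \<forall>j<n. M i j < q) \<and>
     (\<forall>cs. length cs = t \<and> distinct cs \<and> set cs \<subseteq> {..<n} \<longrightarrow>
        (\<forall>w. length w = t \<and> set w \<subseteq> {..<q} \<longrightarrow> (\<exists>i<k. map (M i) cs = w)))"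

definition min_rows :: "nat \<Rightarrow> nat \<Rightarrow> nat" where
  "min_rows q n = (LEAST k. \<exists>M. covering_array 3 q k n M)"

definition A_const :: "nat \<Rightarrow> real" where
  "A_const q = ((real q + 1) - sqrt ((real q + 1)\<^sup>2 - 4)) / 2"

text \<open>For \<open>q \<ge> 3\<close> we have \<open>0 < A_const q < 1\<close>, so every base of \<open>powr\<close> below is positive.\<close>

definition D_const :: "nat \<Rightarrow> real" where
  "D_const q = (let r = real q; A = A_const q in
     ((r - 1) powr (3 * (r - 1)) * (r - A) powr (r - A)) /
     (r powr (2 * r) * A powr A * (1 - A) powr (2 * (1 - A))
        * (r - 2 + A) powr (r - 2 + A) * (r - 1 - A) powr (r - 1 - A)))"

definition B_const :: "nat \<Rightarrow> real" where
  "B_const q = 2 * real q / log 2 (1 / D_const q)"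

end

theory Submission
  imports Defs "HOL-Combinatorics.Multiset_Permutations" "HOL-Real_Asymp.Real_Asymp"
begin

text \<open>
  Choose \<open>2 n\<close> columns independently and uniformly among the words of length \<open>q m\<close> in which every
  letter occurs exactly \<open>m\<close> times. Let \<open>p\<close> bound the probability that three such columns miss a
  given word. If \<open>8 n\<^sup>2 q\<^sup>3 p \<le> 1\<close>, the expected number of defective triples of columns is at
  most \<open>n\<close>; deleting one column from each of them leaves a covering array with \<open>n\<close> columns.
  (Deletion yields the same exponent \<open>n\<^sup>2\<close> as the local lemma.)

  To bound \<open>p\<close>, give each occurrence of the prescribed letter in its column the weight \<open>s > 0\<close>. On
  balanced triples the total weight is \<open>s\<^bsup>3m\<^esup>\<close>, so the number of triples missing the word is at
  most \<open>((s + q - 1)\<^sup>3 - s\<^sup>3)\<^bsup>qm\<^esup> / s\<^bsup>3m\<^esup>\<close>. For the saddle point \<open>s = (q - 1) A / (1 - 2 A)\<close>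
  this equals \<open>(D q\<^bsup>3q\<^esup>)\<^bsup>m\<^esup>\<close>, whence \<open>p \<le> (e m)\<^bsup>3q\<^esup> D\<^bsup>m\<^esup>\<close> and \<open>m \<sim> 2 ln n / ln (1/D)\<close>
  is enough.
\<close>

section \<open>Stirling-type bounds and the number of balanced words\<close>

lemma fact_ge_power: "fact n \<ge> (real n / exp 1) ^ n"
proof -
  \<comment> \<open>The left side is a single term of the exponential series.\<close>
  have "real n ^ n /\<^sub>R fact n \<le> exp (real n)"
    using sum_le_suminf[OF summable_exp_generic[of "real n"], of "{n}"] by (simp add: exp_def)
  also have "exp (real n) = exp 1 ^ n" by (simp flip: exp_of_nat_mult)
  finally show ?thesis by (simp add: field_simps power_divide)
qed

lemma fact_le_power:
  assumes "n \<ge> 1" shows "fact n \<le> exp 1 * real n * (real n / exp 1) ^ n"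
  using assms
proof (induction n rule: dec_induct)
  case base
  then show ?case by simp
next
  case (step n)
  have n: "real n > 0" using step by simp
  \<comment> \<open>\<open>ln x \<le> x - 1\<close> at \<open>x = n / (n + 1)\<close> yields
    \<open>exp 1 \<le> ((n + 1) / n) ^ (n + 1)\<close>, exactly the factor that the induction step
    has to absorb.\<close>
  have "ln (real n / (real n + 1)) \<le> real n / (real n + 1) - 1"
    using n by (intro ln_le_minus_one) auto
  also have "\<dots> = - (1 / (real n + 1))" using n by (simp add: field_simps)
  finally have "1 \<le> real (Suc n) * ln ((real n + 1) / real n)"
    using n by (simp add: ln_div field_simps)
  then have "exp 1 \<le> ((real n + 1) / real n) ^ Suc n"
    using n by (subst ln_ge_iff[symmetric]) (simp_all add: ln_realpow del: power_Suc)
  then have *: "exp 1 * real n ^ Suc n \<le> (real n + 1) ^ Suc n"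
    using n by (simp add: power_divide field_simps)
  have "fact (Suc n) \<le> real (Suc n) * (exp 1 * real n * (real n / exp 1) ^ n)"
    using step by (simp del: of_nat_Suc add: mult_left_mono)
  also have "\<dots> = real (Suc n) * (exp 1 * real n ^ Suc n) / exp 1 ^ n"
    by (simp add: power_divide)
  also have "\<dots> \<le> real (Suc n) * (real n + 1) ^ Suc n / exp 1 ^ n"
    using * by (intro divide_right_mono mult_left_mono) auto
  also have "\<dots> = exp 1 * real (Suc n) * (real (Suc n) / exp 1) ^ Suc n"
    by (simp add: power_divide field_simps)
  finally show ?case .
qed

text \<open>Extensionality makes a word determined by its entries below \<open>q * m\<close>, so the
  set is finite and can be counted.\<close>

definition balanced_words :: "nat \<Rightarrow> nat \<Rightarrow> (nat \<Rightarrow> nat) set" where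
  "balanced_words q m = {f \<in> {..<q * m} \<rightarrow>\<^sub>E {..<q}. \<forall>a<q. card {i. i < q * m \<and> f i = a} = m}"

lemma finite_balanced_words [simp]: "finite (balanced_words q m)"
  unfolding balanced_words_def by (auto intro!: finite_PiE)

text \<open>A multiset with \<open>m\<close> copies of each letter has
  \<open>(q m)! / (m!)^q\<close> arrangements, and reading an arrangement as a function is
  injective.\<close>

lemma multinomial_le_card_balanced_words:
  "fact (q * m) \<le> card (balanced_words q m) * fact m ^ q"
proof -
  define A where "A = (\<Sum>a<q. replicate_mset m a)"
  have count: "count A a = (if a < q then m else 0)" for a
    by (simp add: A_def count_sum)
  have size: "size A = q * m"
    by (simp add: A_def size_multiset_sum)
  have set: "set_mset A \<subseteq> {..<q}"
    using count by (metis lessThan_iff not_in_iff subsetI)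
  define g where "g xs = restrict (nth xs) {..<q * m}" for xs :: "nat list"
  have len: "length xs = q * m" if "xs \<in> permutations_of_multiset A" for xs
    using that size by (auto dest!: permutations_of_multisetD)
  have "g xs \<in> balanced_words q m" if xs: "xs \<in> permutations_of_multiset A" for xs
  proof -
    have "set xs \<subseteq> {..<q}"
      using permutations_of_multisetD[OF xs] set by auto
    then have "xs ! i < q" if "i < q * m" for i
      using nth_mem[of i xs] len[OF xs] that by (metis lessThan_iff subsetD)
    then have "g xs \<in> {..<q * m} \<rightarrow>\<^sub>E {..<q}"
      by (simp add: g_def)
    moreover have "card {i. i < q * m \<and> g xs i = a} = m" if "a < q" for a
    proof -
      have "{i. i < q * m \<and> g xs i = a} = {i. i < length xs \<and> a = xs ! i}"
        using len[OF xs] by (auto simp: g_def)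
      then have "card {i. i < q * m \<and> g xs i = a} = count (mset xs) a"
        by (simp add: count_mset count_list_eq_length_filter length_filter_conv_card)
      then show ?thesis
        using permutations_of_multisetD[OF xs] count that by simp
    qed
    ultimately show ?thesis by (simp add: balanced_words_def)
  qed
  moreover have "inj_on g (permutations_of_multiset A)"
  proof (rule inj_onI)
    fix xs ys assume xs: "xs \<in> permutations_of_multiset A" and ys: "ys \<in> permutations_of_multiset A"
      and eq: "g xs = g ys"
    show "xs = ys"
    proof (rule nth_equalityI)
      show "length xs = length ys" using len xs ys by simp
      show "xs ! i = ys ! i" if "i < length xs" for i
        using fun_cong[OF eq, of i] that len[OF xs] by (simp add: g_def)
    qed
  qed
  ultimately have "card (permutations_of_multiset A) \<le> card (balanced_words q m)"
    by (intro card_inj_on_le[of g]) auto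
  moreover have "(\<Prod>a\<in>set_mset A. fact (count A a)) \<le> (fact m ^ q :: nat)"
  proof -
    have "(\<Prod>a\<in>set_mset A. fact (count A a)) = (\<Prod>a\<in>set_mset A. fact m :: nat)"
      using set by (intro prod.cong) (auto simp: count)
    also have "\<dots> \<le> fact m ^ q"
      using card_mono[OF _ set] by (simp add: power_increasing)
    finally show ?thesis .
  qed
  ultimately show ?thesis
    using card_permutations_of_multiset_aux[of A] unfolding size by (metis mult_le_mono)
qed

text \<open>The factors \<open>(m / e) ^ (q * m)\<close> from the two factorial bounds cancel. What
  is left is polynomial in \<open>m\<close>, so restricting to balanced words costs nothing at the
  exponential scale.\<close>

lemma card_balanced_words_ge:
  assumes "m \<ge> 1"
  shows "real q ^ (q * m) \<le> card (balanced_words q m) * (exp 1 * real m) ^ q"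
proof -
  have "(real (q * m) / exp 1) ^ (q * m) \<le> fact (q * m)"
    by (rule fact_ge_power)
  also have "\<dots> \<le> real (card (balanced_words q m) * fact m ^ q)"
    using multinomial_le_card_balanced_words[of q m] by (metis of_nat_fact of_nat_le_iff)
  also have "\<dots> \<le> card (balanced_words q m) * (exp 1 * real m * (real m / exp 1) ^ m) ^ q"
    using fact_le_power[OF assms] by (auto intro!: mult_left_mono power_mono)
  also have "\<dots> = card (balanced_words q m) * (exp 1 * real m) ^ q * (real m / exp 1) ^ (q * m)"
    by (simp add: power_mult_distrib power_divide power_mult[symmetric] mult.commute)
  finally have "real q ^ (q * m) * (real m / exp 1) ^ (q * m) \<le>
     card (balanced_words q m) * (exp 1 * real m) ^ q * (real m / exp 1) ^ (q * m)"
    by (simp add: power_mult_distrib power_divide)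
  moreover have "(real m / exp 1) ^ (q * m) > 0" using assms by simp
  ultimately show ?thesis by (rule mult_right_le_imp_le)
qed

section \<open>Counting triples of columns that miss a word\<close>

definition avoiding_triples ::
    "nat \<Rightarrow> nat \<Rightarrow> nat \<times> nat \<times> nat \<Rightarrow> ((nat \<Rightarrow> nat) \<times> (nat \<Rightarrow> nat) \<times> (nat \<Rightarrow> nat)) set" where
  "avoiding_triples q m w = {(f, g, h). f \<in> balanced_words q m \<and> g \<in> balanced_words q m \<and>
     h \<in> balanced_words q m \<and> (\<forall>i<q * m. (f i, g i, h i) \<noteq> w)}"

lemma sum_weight_letter:
  fixes s :: real assumes "a < q"
  shows "(\<Sum>x<q. if x = a then s else 1) = s + real q - 1"
proof -
  have "(\<Sum>x<q. if x = a then s else 1) = s + (\<Sum>x\<in>{..<q}-{a}. if x = a then s else 1)"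
    using assms by (subst sum.remove[of _ a]) auto
  also have "(\<Sum>x\<in>{..<q}-{a}. if x = a then s else 1) = (\<Sum>x\<in>{..<q}-{a}. 1 :: real)"
    by (intro sum.cong) auto
  finally show ?thesis using assms by (simp add: of_nat_diff)
qed

lemma prod_weight_letter:
  fixes s :: real assumes "f \<in> balanced_words q m" "a < q"
  shows "(\<Prod>i<q * m. if f i = a then s else 1) = s ^ m"
proof -
  have "(\<Prod>i<q * m. if f i = a then s else 1) = (\<Prod>i\<in>{i. i < q * m \<and> f i = a}. s)"
    by (rule prod.mono_neutral_cong_right) auto
  then show ?thesis using assms by (simp add: balanced_words_def)
qed

lemma card_avoiding_triples_le:
  fixes s :: real
  assumes s: "s > 0" and abc: "a < q" "b < q" "c < q"
  shows "card (avoiding_triples q m (a, b, c)) * s ^ (3 * m) \<le> ((s + real q - 1) ^ 3 - s ^ 3) ^ (q * m)"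
proof -
  define X where "X = {..<q} \<times> {..<q} \<times> {..<q} - {(a, b, c)}"
  define u where "u x y = (if x = y then s else 1)" for x y :: nat
  define w where "w p = (case p of (x, y, z) \<Rightarrow> u x a * (u y b * u z c))" for p
  have w0: "w p \<ge> 0" for p using s by (auto simp: w_def u_def split: prod.split)
  have "(\<Sum>p\<in>{..<q} \<times> {..<q} \<times> {..<q}. w p) = (s + real q - 1) ^ 3"
    using abc by (simp add: w_def u_def sum_weight_letter power3_eq_cube
      flip: sum.cartesian_product sum_distrib_left sum_distrib_right)
  moreover have "w (a, b, c) = s ^ 3" by (simp add: w_def u_def power3_eq_cube)
  ultimately have sumX: "(\<Sum>p\<in>X. w p) = (s + real q - 1) ^ 3 - s ^ 3"
    using abc by (simp add: X_def sum_diff1)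
  \<comment> \<open>\<open>\<phi>\<close> reads three columns as one sequence of rows. Avoidance
    puts every row into \<open>X\<close>, and balance fixes the total weight at
    \<open>s ^ (3 * m)\<close>.\<close>
  define \<phi> where "\<phi> t = (case t of (f, g, h) \<Rightarrow> restrict (\<lambda>i. (f i, g i, h i)) {..<q * m})"
    for t :: "(nat \<Rightarrow> nat) \<times> (nat \<Rightarrow> nat) \<times> (nat \<Rightarrow> nat)"
  let ?B = "avoiding_triples q m (a, b, c)"
  have inj: "inj_on \<phi> ?B"
  proof (rule inj_onI)
    fix t t' assume t: "t \<in> ?B" "t' \<in> ?B" and eq: "\<phi> t = \<phi> t'"
    obtain f g h f' g' h' where [simp]: "t = (f, g, h)" "t' = (f', g', h')"
      by (metis prod_cases3)
    have "f i = f' i \<and> g i = g' i \<and> h i = h' i" if "i < q * m" for i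
      using fun_cong[OF eq, of i] that by (simp add: \<phi>_def)
    then show "t = t'"
      using t by (auto simp: avoiding_triples_def balanced_words_def intro!: PiE_ext[of _ "{..<q * m}"])
  qed
  have weight: "(\<Prod>i<q * m. w (\<phi> t i)) = s ^ (3 * m)" if "t \<in> ?B" for t
  proof -
    obtain f g h where [simp]: "t = (f, g, h)" by (metis prod_cases3)
    have "(\<Prod>i<q * m. w (\<phi> t i)) = (\<Prod>i<q * m. u (f i) a * (u (g i) b * u (h i) c))"
      by (intro prod.cong) (auto simp: \<phi>_def w_def)
    also have "\<dots> = s ^ m * (s ^ m * s ^ m)"
      using that abc by (simp add: prod.distrib u_def prod_weight_letter avoiding_triples_def)
    also have "\<dots> = s ^ (3 * m)"
      by (simp add: numeral_3_eq_3 power_add)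
    finally show ?thesis .
  qed
  have "\<phi> ` ?B \<subseteq> {..<q * m} \<rightarrow>\<^sub>E X"
  proof
    fix p assume "p \<in> \<phi> ` ?B"
    then show "p \<in> {..<q * m} \<rightarrow>\<^sub>E X"
      by (fastforce simp: \<phi>_def X_def avoiding_triples_def balanced_words_def)
  qed
  have "card ?B * s ^ (3 * m) = (\<Sum>t\<in>?B. \<Prod>i<q * m. w (\<phi> t i))"
    using weight by simp
  also have "\<dots> = (\<Sum>p\<in>\<phi> ` ?B. \<Prod>i<q * m. w (p i))"
    using inj by (simp add: sum.reindex)
  \<comment> \<open>Passing to all row sequences over \<open>X\<close> forgets balance: it adds only
    nonnegative terms and lets the sum factor row by row.\<close>
  also have "\<dots> \<le> (\<Sum>p\<in>{..<q * m} \<rightarrow>\<^sub>E X. \<Prod>i<q * m. w (p i))"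
    using \<open>\<phi> ` ?B \<subseteq> _\<close> w0 by (intro sum_mono2 finite_PiE prod_nonneg) (auto simp: X_def)
  also have "\<dots> = (\<Prod>i<q * m. \<Sum>p\<in>X. w p)"
    by (rule prod_sum_PiE[symmetric]) (auto simp: X_def)
  also have "\<dots> = ((s + real q - 1) ^ 3 - s ^ 3) ^ (q * m)"
    by (simp add: sumX)
  finally show ?thesis .
qed

text \<open>In probabilistic terms, three distinct coordinates of a uniform choice are independent
  and uniform. The set splits into disjoint boxes \<open>F' t\<close>, with singleton factors at
  \<open>x\<close>, \<open>y\<close>, \<open>z\<close> and the factor \<open>S\<close>
  elsewhere.\<close>

lemma card_PiE_three_fixed:
  assumes "finite S" "x \<noteq> y" "x \<noteq> z" "y \<noteq> z" "x < N" "y < N" "z < N"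
    and T: "T \<subseteq> S \<times> S \<times> S"
  shows "card {\<omega> \<in> {..<N} \<rightarrow>\<^sub>E S. (\<omega> x, \<omega> y, \<omega> z) \<in> T} = card T * card S ^ (N - 3)"
proof -
  define F' where "F' t = (case t of (f, g, h) \<Rightarrow>
     PiE {..<N} (\<lambda>i. if i = x then {f} else if i = y then {g} else if i = z then {h} else S))"
     for t :: "'a \<times> 'a \<times> 'a"
  have fT: "finite T" using T assms(1) by (metis finite_SigmaI finite_subset)
  have card: "card (F' t) = card S ^ (N - 3)" if "t \<in> T" for t
  proof -
    obtain f g h where [simp]: "t = (f, g, h)" by (metis prod_cases3)
    have "card (F' t) = (\<Prod>i<N. card (if i = x then {f} else if i = y then {g} else if i = z then {h} else S))"
      by (simp add: F'_def card_PiE)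
    also have "\<dots> = (\<Prod>i\<in>{..<N} - {x, y, z}. card S)"
      by (rule prod.mono_neutral_cong_right) auto
    also have "\<dots> = card S ^ (N - 3)"
      using assms by (simp add: card_Diff_subset numeral_3_eq_3)
    finally show ?thesis .
  qed
  have mem: "\<omega> x = f \<and> \<omega> y = g \<and> \<omega> z = h \<and> \<omega> \<in> {..<N} \<rightarrow>\<^sub>E S"
    if \<omega>: "\<omega> \<in> F' (f, g, h)" and t: "(f, g, h) \<in> T" for \<omega> f g h
  proof -
    have *: "\<omega> i \<in> (if i = x then {f} else if i = y then {g} else if i = z then {h} else S)"
        if "i < N" for i
      using PiE_mem[of \<omega> "{..<N}" _ i] \<omega> that unfolding F'_def prod.case by blast
    have "\<omega> i \<in> S" if "i < N" for i
      using *[OF that] t T by (auto split: if_splits)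
    moreover have "\<omega> \<in> extensional {..<N}"
      using \<omega> unfolding F'_def prod.case PiE_def by blast
    ultimately show ?thesis
      using *[of x] *[of y] *[of z] assms by (simp add: PiE_iff)
  qed
  have "{\<omega> \<in> {..<N} \<rightarrow>\<^sub>E S. (\<omega> x, \<omega> y, \<omega> z) \<in> T} = (\<Union>t\<in>T. F' t)"
  proof (intro set_eqI iffI)
    fix \<omega> assume "\<omega> \<in> {\<omega> \<in> {..<N} \<rightarrow>\<^sub>E S. (\<omega> x, \<omega> y, \<omega> z) \<in> T}"
    then show "\<omega> \<in> (\<Union>t\<in>T. F' t)"
      by (intro UN_I[of "(\<omega> x, \<omega> y, \<omega> z)"]) (simp_all add: F'_def PiE_iff)
  next
    fix \<omega> assume "\<omega> \<in> (\<Union>t\<in>T. F' t)"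
    then obtain t where "t \<in> T" "\<omega> \<in> F' t" by blast
    moreover obtain f g h where "t = (f, g, h)" by (metis prod_cases3)
    ultimately show "\<omega> \<in> {\<omega> \<in> {..<N} \<rightarrow>\<^sub>E S. (\<omega> x, \<omega> y, \<omega> z) \<in> T}"
      using mem[of \<omega> f g h] by simp
  qed
  moreover have "card (\<Union>t\<in>T. F' t) = (\<Sum>t\<in>T. card (F' t))"
  proof (rule card_UN_disjoint[OF fT])
    show "\<forall>t\<in>T. finite (F' t)"
      using assms(1) by (auto simp: F'_def intro!: finite_PiE)
    show "\<forall>t\<in>T. \<forall>t'\<in>T. t \<noteq> t' \<longrightarrow> F' t \<inter> F' t' = {}"
    proof (intro ballI impI)
      have eq: "t = (\<omega> x, \<omega> y, \<omega> z)" if "\<omega> \<in> F' t" "t \<in> T" for \<omega> t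
        using that mem by (cases t) blast
      fix t t' assume "t \<noteq> t'" "t \<in> T" "t' \<in> T"
      then show "F' t \<inter> F' t' = {}" using eq by blast
    qed
  qed
  ultimately show ?thesis using card by simp
qed

section \<open>The constants A and D and the saddle point\<close>

lemma A_const_props:
  assumes "q \<ge> 3"
  shows "0 < A_const q" "2 * A_const q < 1" "(A_const q)\<^sup>2 - (real q + 1) * A_const q + 1 = 0"
proof -
  define r where "r = real q"
  define S where "S = sqrt ((r + 1)\<^sup>2 - 4)"
  have r: "r \<ge> 3" using assms by (simp add: r_def)
  then have ge: "(r + 1)\<^sup>2 - 4 > r\<^sup>2" by (simp add: power2_eq_square algebra_simps)
  then have S2: "S\<^sup>2 = (r + 1)\<^sup>2 - 4"
    using order.trans[OF zero_le_power2 less_imp_le[OF ge]] unfolding S_def by (intro real_sqrt_pow2) simp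
  \<comment> \<open>Both bounds on A amount to \<open>r < S < r + 1\<close>.\<close>
  have "S < r + 1" unfolding S_def using r by (intro real_less_lsqrt) auto
  moreover have "r < S" unfolding S_def using ge by (rule real_less_rsqrt)
  moreover have A: "A_const q = (r + 1 - S) / 2" by (simp add: A_const_def r_def S_def)
  ultimately show "0 < A_const q" "2 * A_const q < 1" by auto
  show "(A_const q)\<^sup>2 - (real q + 1) * A_const q + 1 = 0"
    using S2 by (simp add: A r_def[symmetric] power2_eq_square field_simps)
qed

text \<open>For \<open>q \<ge> 3\<close> this is the weight \<open>s\<close> with
  \<open>s / (s + q - 1) = A / (1 - A)\<close>.\<close>

definition weight_const :: "nat \<Rightarrow> real" where
  "weight_const q = (real q - 1) * A_const q / (1 - 2 * A_const q)"

lemma weight_const_pos: "q \<ge> 3 \<Longrightarrow> weight_const q > 0"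
  using A_const_props[of q] by (simp add: weight_const_def)

text \<open>Over the denominator \<open>1 - 2 * A\<close> the two bases are \<open>r - 1\<close>
  times \<open>1 - A\<close> and \<open>A\<close>. Their difference of cubes contains
  \<open>1 - A + A^2\<close>, which the quadratic for A turns into \<open>r * A\<close>.\<close>

lemma weight_cubes:
  assumes "q \<ge> 3"
  shows "(weight_const q + real q - 1) ^ 3 - weight_const q ^ 3 =
    (real q - 1) ^ 3 * (real q * A_const q) / (1 - 2 * A_const q)\<^sup>2"
proof -
  define A r where "A = A_const q" and "r = real q"
  note A = A_const_props[OF assms, folded A_def r_def]
  have u: "1 - 2 * A \<noteq> 0" using A by simp
  have 1: "weight_const q + real q - 1 = (r - 1) * (1 - A) / (1 - 2 * A)"
    using u by (simp add: weight_const_def A_def[symmetric] r_def[symmetric] field_simps)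
  have 2: "weight_const q = (r - 1) * A / (1 - 2 * A)"
    by (simp add: weight_const_def A_def r_def)
  have "(1 - A) ^ 3 - A ^ 3 = (1 - 2 * A) * (1 - A + A\<^sup>2)"
    by (simp add: power3_eq_cube power2_eq_square algebra_simps)
  also have "1 - A + A\<^sup>2 = r * A" using A by (simp add: algebra_simps)
  finally have 3: "(1 - A) ^ 3 - A ^ 3 = (1 - 2 * A) * (r * A)" .
  have "(weight_const q + real q - 1) ^ 3 - weight_const q ^ 3 =
     (r - 1) ^ 3 * ((1 - A) ^ 3 - A ^ 3) / (1 - 2 * A) ^ 3"
    unfolding 1 unfolding 2 power_divide power_mult_distrib
    by (simp only: diff_divide_distrib right_diff_distrib)
  also have "\<dots> = (r - 1) ^ 3 * (r * A) / (1 - 2 * A)\<^sup>2"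
    unfolding 3 using u by (simp add: power3_eq_cube power2_eq_square)
  finally show ?thesis by (simp add: A_def r_def)
qed

text \<open>This links the explicit constant to the weighted count:
  \<open>D ^ m * q ^ (3 * q * m)\<close> is the bound on avoiding triples at the weight
  \<open>s\<close>. Both sides are positive, so it suffices to compare logarithms.\<close>

lemma D_const_eq:
  assumes "q \<ge> 3"
  defines "s \<equiv> weight_const q"
  shows "D_const q = ((s + real q - 1) ^ 3 - s ^ 3) ^ q / (s ^ 3 * real q ^ (3 * q))"
proof -
  define A r where "A = A_const q" and "r = real q"
  note A = A_const_props[OF assms(1), folded A_def r_def]
  have r: "r \<ge> 3" using assms by (simp add: r_def)
  define P R L M N where "P = ln (r - 1)" and "R = ln r" and "L = ln A"
    and "M = ln (1 - A)" and "N = ln (1 - 2 * A)"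
  note defs = P_def R_def L_def M_def N_def
  have sq: "A * A = (r + 1) * A - 1" using A by (simp add: power2_eq_square)
  \<comment> \<open>The quadratic factors the remaining bases of D into A, \<open>1 - A\<close> and
    \<open>1 - 2 * A\<close>.\<close>
  have e1: "r - A = (1 - A) / A" and e2: "r - 1 - A = (1 - 2 * A) / A"
    and e3: "r - 2 + A = (1 - A) * (1 - 2 * A) / A"
    using A sq by (simp_all add: field_simps)
  have l: "ln (r - A) = M - L" "ln (r - 1 - A) = N - L" "ln (r - 2 + A) = M + N - L"
    unfolding e1 e2 e3 using A by (simp_all add: defs ln_div ln_mult)
  have "ln (D_const q) = 3 * (r - 1) * P + (r - A) * (M - L)
     - (2 * r * R + A * L + 2 * (1 - A) * M + (r - 2 + A) * (M + N - L) + (r - 1 - A) * (N - L))"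
    unfolding D_const_def Let_def A_def[symmetric] r_def[symmetric]
    using A r by (simp add: ln_div ln_mult ln_powr l defs[symmetric])
  \<comment> \<open>The total coefficient of \<open>M\<close> is zero, so \<open>1 - A\<close> drops
    out.\<close>
  also have "\<dots> = r * (3 * P + R + L - 2 * N) - (3 * (P + L - N) + 3 * r * R)"
    by (simp add: algebra_simps)
  also have "\<dots> = ln (((s + real q - 1) ^ 3 - s ^ 3) ^ q / (s ^ 3 * real q ^ (3 * q)))"
  proof -
    have "ln ((s + real q - 1) ^ 3 - s ^ 3) = 3 * P + R + L - 2 * N"
      unfolding s_def weight_cubes[OF assms(1)] unfolding A_def[symmetric] r_def[symmetric]
      using A r by (simp add: ln_div ln_mult ln_realpow defs)
    moreover have "ln s = P + L - N"
      unfolding s_def weight_const_def A_def[symmetric] r_def[symmetric]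
      using A r by (simp add: ln_div ln_mult defs)
    moreover have "(s + real q - 1) ^ 3 - s ^ 3 > 0" "s > 0"
      using r by (auto simp: s_def weight_const_pos[OF assms(1)] r_def intro!: power_strict_mono less_imp_le)
    ultimately show ?thesis
      using r by (simp add: ln_div ln_mult ln_realpow R_def r_def)
  qed
  finally show ?thesis
  proof (rule ln_inj_iff[THEN iffD1, rotated -1])
    show "0 < D_const q"
      unfolding D_const_def Let_def A_def[symmetric] r_def[symmetric] using A r by simp
    show "0 < ((s + real q - 1) ^ 3 - s ^ 3) ^ q / (s ^ 3 * real q ^ (3 * q))"
      using r weight_const_pos[OF assms(1)]
      by (auto simp: s_def r_def intro!: divide_pos_pos mult_pos_pos zero_less_power power_strict_mono)
  qed
qed

lemma D_const_bounds:
  assumes "q \<ge> 3"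
  shows "0 < D_const q" "D_const q < 1"
proof -
  define A r where "A = A_const q" and "r = real q"
  note A = A_const_props[OF assms(1), folded A_def r_def]
  have r: "r \<ge> 3" using assms by (simp add: r_def)
  show "0 < D_const q"
    unfolding D_const_def Let_def A_def[symmetric] r_def[symmetric] using A r by simp
  define s p where "s = weight_const q" and "p = r - 1"
  define W where "W = (s + r - 1) ^ 3 - s ^ 3"
  have s: "s > 0" using weight_const_pos[OF assms] by (simp add: s_def)
  have p: "p > 0" using r by (simp add: p_def)
  \<comment> \<open>The summands weigh the rows with 0, 1 and 2 agreements with the avoided word.
    The identity \<open>mean\<close> below says that the mean number of agreements is
    \<open>3 / r\<close>.\<close>
  have W: "W = p ^ 3 + 3 * p\<^sup>2 * s + 3 * p * s\<^sup>2"
    by (simp add: W_def p_def power3_eq_cube power2_eq_square algebra_simps)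
  have W0: "W > 0" unfolding W using s p by (intro add_pos_pos) auto
  have mean: "r * (3 * p\<^sup>2 * s + 6 * p * s\<^sup>2) = 3 * W"
  proof -
    have u: "1 - 2 * A > 0" using A by simp
    have se: "s = p * A / (1 - 2 * A)"
      by (simp add: s_def weight_const_def p_def A_def r_def)
    have "3 * p\<^sup>2 * s + 6 * p * s\<^sup>2 = 3 * p ^ 3 * A / (1 - 2 * A)\<^sup>2"
      unfolding se using u by (simp add: power2_eq_square power3_eq_cube divide_simps) (simp add: algebra_simps)
    moreover have "W = p ^ 3 * (r * A) / (1 - 2 * A)\<^sup>2"
      using weight_cubes[OF assms] by (simp add: W_def s_def r_def p_def A_def)
    ultimately show ?thesis by simp
  qed
  text \<open>\<open>mean\<close> says that \<open>s\<close> is a critical point of \<open>((s + r - 1) ^ 3 - s ^ 3) ^ q / s ^ 3\<close>. Weighted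
    AM-GM, in tangent-line form, makes it a minimum; the comparison value is the one at \<open>s = 1\<close>.\<close>
  define d c where "d = - ln s" and "c = 3 * d / r"
  have ed: "exp d = 1 / s" "exp (2 * d) = 1 / s\<^sup>2"
    using s by (simp_all add: d_def exp_minus exp_double inverse_eq_divide power_one_over)
  have tangent: "exp x \<ge> exp c * (1 + x - c)" for x
    using exp_ge_add_one_self[of "x - c"] mult_left_mono[of "1 + (x - c)" "exp (x - c)" "exp c"]
    by (simp add: exp_diff algebra_simps)
  \<comment> \<open>Changing the weight from \<open>s\<close> to 1 multiplies the summand with
    \<open>j\<close> agreements by \<open>exp (j * d)\<close>. Since \<open>c\<close> is the mean of
    \<open>j * d\<close>, the linear terms of the tangents at \<open>c\<close> cancel.\<close>
  have "exp c * W = p ^ 3 * (exp c * (1 + 0 - c)) + 3 * p\<^sup>2 * s * (exp c * (1 + d - c))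
      + 3 * p * s\<^sup>2 * (exp c * (1 + 2 * d - c))"
  proof -
    have "d * (3 * p\<^sup>2 * s + 6 * p * s\<^sup>2) = c * W"
      using arg_cong[OF mean, of "\<lambda>x. d * x / r"] r by (simp add: c_def field_simps)
    then have "exp c * W = exp c * (W * (1 - c) + d * (3 * p\<^sup>2 * s + 6 * p * s\<^sup>2))"
      by (simp add: algebra_simps)
    then show ?thesis by (simp add: W algebra_simps)
  qed
  also have "\<dots> \<le> p ^ 3 * exp 0 + 3 * p\<^sup>2 * s * exp d + 3 * p * s\<^sup>2 * exp (2 * d)"
    using s p by (intro add_mono mult_left_mono tangent) auto
  also have "\<dots> = r ^ 3 - 1"
    using s unfolding ed by (simp add: p_def power3_eq_cube power2_eq_square algebra_simps)
  finally have le: "exp c * W \<le> r ^ 3 - 1" .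
  have "W ^ q / s ^ 3 = (exp c * W) ^ q"
  proof -
    have "exp c ^ q = exp (3 * d)" using r by (simp add: c_def r_def flip: exp_of_nat_mult)
    also have "\<dots> = 1 / s ^ 3"
      using s by (simp add: d_def exp_minus exp_of_nat_mult[of 3, simplified] inverse_eq_divide power_one_over)
    finally show ?thesis by (simp add: power_mult_distrib)
  qed
  \<comment> \<open>Strictness comes from the 1 in \<open>r ^ 3 - 1\<close>, the excluded
    row.\<close>
  also have "\<dots> < (r ^ 3) ^ q"
    using le W0 assms by (intro power_strict_mono) auto
  finally have "W ^ q / s ^ 3 < r ^ (3 * q)" by (simp add: power_mult)
  moreover have "D_const q = W ^ q / s ^ 3 / r ^ (3 * q)"
    using D_const_eq[OF assms] by (simp add: W_def s_def r_def)
  ultimately show "D_const q < 1"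
    using r by (simp only: divide_less_eq_1) simp
qed

section \<open>Random columns and deletion\<close>

lemma exists_covering_array:
  assumes n: "n \<ge> 2" and ne: "balanced_words q m \<noteq> {}"
    and b: "\<And>a b c. a < q \<Longrightarrow> b < q \<Longrightarrow> c < q \<Longrightarrow> card (avoiding_triples q m (a, b, c)) \<le> \<beta>"
    and le: "8 * n\<^sup>2 * q ^ 3 * \<beta> \<le> card (balanced_words q m) ^ 3"
  shows "\<exists>M. covering_array 3 q (q * m) n M"
proof -
  define S where "S = balanced_words q m"
  \<comment> \<open>Twice as many columns are drawn as are kept, so that \<open>n\<close> may be
    deleted.\<close>
  define N where "N = 2 * n"
  define Q where "Q = {..<q} \<times> {..<q} \<times> {..<q}"
  define T where "T = (\<Union>w\<in>Q. avoiding_triples q m w)"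
  define P where "P = {(x, y, z). x < N \<and> y < N \<and> z < N \<and> x \<noteq> y \<and> x \<noteq> z \<and> y \<noteq> z}"
  define R where "R \<omega> p = (case p of (x, y, z) \<Rightarrow> (\<omega> x, \<omega> y, \<omega> z) \<in> T)"
    for \<omega> :: "nat \<Rightarrow> nat \<Rightarrow> nat" and p :: "nat \<times> nat \<times> nat"
  define \<Omega> where "\<Omega> = {..<N} \<rightarrow>\<^sub>E S"
  have S: "finite S" "card S > 0"
    using ne by (auto simp: S_def card_gt_0_iff)
  have T: "T \<subseteq> S \<times> S \<times> S" by (auto simp: T_def S_def avoiding_triples_def)
  have P: "P \<subseteq> {..<N} \<times> {..<N} \<times> {..<N}" by (auto simp: P_def)
  then have finP: "finite P" by (rule finite_subset) auto
  have cardP: "card P \<le> N ^ 3"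
    using card_mono[OF _ P] by (simp add: card_cartesian_product power3_eq_cube mult.assoc)
  have fin\<Omega>: "finite \<Omega>" using S by (auto simp: \<Omega>_def intro: finite_PiE)
  have card\<Omega>: "card \<Omega> = card S ^ N" by (simp add: \<Omega>_def card_PiE)
  have cardT: "card T \<le> q ^ 3 * \<beta>"
  proof -
    have "card T \<le> (\<Sum>w\<in>Q. card (avoiding_triples q m w))"
      unfolding T_def by (rule card_UN_le) (simp add: Q_def)
    also have "\<dots> \<le> (\<Sum>w\<in>Q. \<beta>)"
      by (rule sum_mono) (auto simp: Q_def b)
    also have "\<dots> = q ^ 3 * \<beta>"
      by (simp add: Q_def card_cartesian_product power3_eq_cube mult.assoc)
    finally show ?thesis .
  qed
  \<comment> \<open>Double counting of pairs of a choice and a defective ordered triple.\<close>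
  have "(\<Sum>\<omega>\<in>\<Omega>. card {p \<in> P. R \<omega> p}) = (\<Sum>p\<in>P. card T * card S ^ (N - 3))"
    using S T by (intro sum_multicount_gen fin\<Omega> finP)
      (auto simp: P_def R_def \<Omega>_def card_PiE_three_fixed)
  also have "\<dots> \<le> N ^ 3 * (q ^ 3 * \<beta> * card S ^ (N - 3))"
    using cardP cardT by (simp add: mult_le_mono)
  \<comment> \<open>\<open>N ^ 3 = n * (8 * n^2)\<close> explains the factor \<open>8 * n^2\<close>
    in the hypothesis.\<close>
  also have "\<dots> = n * (8 * n\<^sup>2 * q ^ 3 * \<beta>) * card S ^ (N - 3)"
    by (simp add: N_def power3_eq_cube power2_eq_square)
  also have "\<dots> \<le> n * card S ^ 3 * card S ^ (N - 3)"
    using le by (simp add: S_def)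
  also have "\<dots> = (\<Sum>\<omega>\<in>\<Omega>. n)"
    using n by (simp add: card\<Omega> N_def flip: power_add)
  finally have sum: "(\<Sum>\<omega>\<in>\<Omega>. card {p \<in> P. R \<omega> p}) \<le> (\<Sum>\<omega>\<in>\<Omega>. n)" .
  \<comment> \<open>Some choice has at most the average number of defects.\<close>
  obtain \<omega> where \<omega>: "\<omega> \<in> \<Omega>" and few: "card {p \<in> P. R \<omega> p} \<le> n"
  proof -
    have "\<Omega> \<noteq> {}" using S card\<Omega> by fastforce
    then show ?thesis
      using sum_strict_mono[OF fin\<Omega>, of "\<lambda>_. n" "\<lambda>\<omega>. card {p \<in> P. R \<omega> p}"] sum that
      by (meson leD not_le)
  qed
  \<comment> \<open>Deleting the first column of each defective triple destroys all of them.\<close>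
  define J where "J = {..<N} - fst ` {p \<in> P. R \<omega> p}"
  have "card J \<ge> N - card (fst ` {p \<in> P. R \<omega> p})"
    unfolding J_def using diff_card_le_card_Diff[of "fst ` {p \<in> P. R \<omega> p}" "{..<N}"] finP by simp
  moreover have "card (fst ` {p \<in> P. R \<omega> p}) \<le> n"
    using card_image_le[of "{p \<in> P. R \<omega> p}" fst] finP few by simp
  ultimately have cardJ: "n \<le> card J" by (simp add: N_def)
  \<comment> \<open>\<open>e\<close> renumbers the surviving columns; the first \<open>n\<close>
    form the array.\<close>
  obtain e where e: "bij_betw e {0..<card J} J"
    using ex_bij_betw_nat_finite[of J] by (auto simp: J_def)
  have eJ: "e j \<in> J" if "j < n" for j
    using e that cardJ by (auto simp: bij_betw_def)
  have einj: "e i \<noteq> e j" if "i < n" "j < n" "i \<noteq> j" for i j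
    using e that cardJ by (auto simp: bij_betw_def inj_on_def)
  have \<omega>S: "\<omega> (e j) \<in> balanced_words q m" if "j < n" for j
    using \<omega> eJ[OF that] by (auto simp: \<Omega>_def S_def J_def)
  have "covering_array 3 q (q * m) n (\<lambda>i j. \<omega> (e j) i)"
    unfolding covering_array_def
  proof (intro conjI allI impI)
    fix i j assume "i < q * m" "j < n"
    then show "\<omega> (e j) i < q"
      using \<omega>S[of j] by (auto simp: balanced_words_def)
  next
    fix cs w :: "nat list"
    assume cs: "length cs = 3 \<and> distinct cs \<and> set cs \<subseteq> {..<n}"
      and w: "length w = 3 \<and> set w \<subseteq> {..<q}"
    obtain x y z where cs': "cs = [x, y, z]"
      using cs by (auto simp: numeral_3_eq_3 length_Suc_conv)
    obtain a b c where w': "w = [a, b, c]"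
      using w by (auto simp: numeral_3_eq_3 length_Suc_conv)
    have xyz: "x < n" "y < n" "z < n" "x \<noteq> y" "x \<noteq> z" "y \<noteq> z"
      using cs by (auto simp: cs')
    have "(e x, e y, e z) \<in> P"
      using eJ[of x] eJ[of y] eJ[of z] einj xyz by (simp add: P_def J_def)
    moreover have "e x \<notin> fst ` {p \<in> P. R \<omega> p}"
      using eJ[of x] xyz by (simp add: J_def)
    ultimately have "\<not> R \<omega> (e x, e y, e z)" by force
    then have "(\<omega> (e x), \<omega> (e y), \<omega> (e z)) \<notin> avoiding_triples q m (a, b, c)"
      using w by (auto simp: R_def T_def Q_def w')
    then show "\<exists>i<q * m. map (\<lambda>j. \<omega> (e j) i) cs = w"
      using \<omega>S xyz by (auto simp: avoiding_triples_def cs' w')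
  qed
  then show ?thesis by blast
qed

section \<open>The number of rows and its asymptotics\<close>

lemma min_rows_le:
  assumes q: "q \<ge> 3" and n: "n \<ge> 2" and m: "m \<ge> 1"
    and le: "8 * real n ^ 2 * real q ^ 3 * (exp 1 * real m) ^ (3 * q) * D_const q ^ m \<le> 1"
  shows "min_rows q n \<le> q * m"
proof -
  define s where "s = weight_const q"
  have s: "s > 0" using q by (simp add: s_def weight_const_pos)
  let ?W = "(s + real q - 1) ^ 3 - s ^ 3" and ?c = "card (balanced_words q m)"
  \<comment> \<open>Cardinalities are integers, so rounding down loses nothing.\<close>
  define \<beta> where "\<beta> = nat \<lfloor>?W ^ (q * m) / s ^ (3 * m)\<rfloor>"
  have W: "?W > 0" using q s by (auto intro!: power_strict_mono)
  have D: "D_const q ^ m * (real q ^ (q * m)) ^ 3 = ?W ^ (q * m) / s ^ (3 * m)"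
    using q by (simp add: D_const_eq[OF q] s_def power_divide power_mult_distrib mult_ac flip: power_mult)
  have \<beta>: "real \<beta> \<le> D_const q ^ m * (real q ^ (q * m)) ^ 3"
    unfolding D \<beta>_def using W s by simp
  \<comment> \<open>Comparing with balanced words costs \<open>(e m) ^ q\<close> for each of three
    columns, hence the exponent \<open>3 * q\<close> in the hypothesis.\<close>
  also have "\<dots> \<le> D_const q ^ m * (?c * (exp 1 * real m) ^ q) ^ 3"
    using D_const_bounds[OF q] card_balanced_words_ge[OF m, of q]
    by (intro mult_left_mono power_mono) auto
  finally have "8 * real n ^ 2 * real q ^ 3 * real \<beta> \<le>
      8 * real n ^ 2 * real q ^ 3 * (D_const q ^ m * (?c * (exp 1 * real m) ^ q) ^ 3)"
    by (intro mult_left_mono) auto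
  also have "\<dots> = (8 * real n ^ 2 * real q ^ 3 * (exp 1 * real m) ^ (3 * q) * D_const q ^ m) * real ?c ^ 3"
    by (simp add: power_mult_distrib mult_ac flip: power_mult)
  also have "\<dots> \<le> 1 * real ?c ^ 3"
    using le by (intro mult_right_mono) auto
  finally have "real (8 * n\<^sup>2 * q ^ 3 * \<beta>) \<le> real (?c ^ 3)" by simp
  then have "8 * n\<^sup>2 * q ^ 3 * \<beta> \<le> ?c ^ 3" by (simp only: of_nat_le_iff)
  moreover have "card (avoiding_triples q m (a, b, c)) \<le> \<beta>" if "a < q" "b < q" "c < q" for a b c
    using card_avoiding_triples_le[OF s that, of m] s
    unfolding \<beta>_def by (intro le_nat_floor) (simp add: field_simps)
  moreover have "balanced_words q m \<noteq> {}"
  proof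
    assume "balanced_words q m = {}"
    then have "real q ^ (q * m) \<le> 0" using card_balanced_words_ge[OF m, of q] by simp
    moreover have "real q ^ (q * m) > 0" using q by (intro zero_less_power) simp
    ultimately show False by simp
  qed
  ultimately have "\<exists>M. covering_array 3 q (q * m) n M"
    using exists_covering_array n by blast
  then show ?thesis unfolding min_rows_def by (rule Least_le)
qed

theorem theorem3:
  fixes q :: nat
  assumes "q \<ge> 3"
  shows "\<exists>\<epsilon> :: nat \<Rightarrow> real. \<epsilon> \<in> o(\<lambda>_. 1) \<and>
           (\<forall>\<^sub>F n in sequentially.
              real (min_rows q n) \<le> B_const q * log 2 (real n) * (1 + \<epsilon> n))"
proof -
  define l r where "l = ln (1 / D_const q)" and "r = real q"
  note D = D_const_bounds[OF assms]
  have l: "l > 0" using D by (simp add: l_def)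
  have r: "r \<ge> 3" using assms by (simp add: r_def)
  \<comment> \<open>The main term cancels the factor \<open>n^2\<close>. The surplus
    \<open>sqrt (ln n)\<close> beats the polynomial factor in \<open>m\<close> and is still
    \<open>o(ln n)\<close>.\<close>
  define X where "X n = 2 * ln (real n) / l + sqrt (ln (real n))" for n :: nat
  define m where "m n = nat \<lceil>X n\<rceil>" for n
  \<comment> \<open>Solved from the requirement that the claimed bound equal
    \<open>q * m n\<close>.\<close>
  define \<epsilon> where "\<epsilon> n = real (m n) * l / (2 * ln (real n)) - 1" for n
  have m: "X n \<le> real (m n)" "real (m n) \<le> X n + 1" "m n \<ge> 1" if "n \<ge> 2" for n
  proof -
    have "X n > 0" using that l by (simp add: X_def add_pos_pos)
    then show "X n \<le> real (m n)" "real (m n) \<le> X n + 1" "m n \<ge> 1"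
      unfolding m_def by linarith+
  qed
  \<comment> \<open>Logarithm of the condition on \<open>m\<close>, with \<open>n^2\<close> already
    cancelled.\<close>
  have "filterlim (\<lambda>n::nat. ln 8 + 3 * ln r + 3 * r * ln (exp 1 * (2 * ln n / l + sqrt (ln n) + 1))
      - l * sqrt (ln n)) at_bot sequentially"
    using l r by real_asymp
  then have "\<forall>\<^sub>F n in sequentially. ln 8 + 3 * ln r + 3 * r * ln (exp 1 * (X n + 1)) - l * sqrt (ln n) \<le> 0"
    unfolding X_def filterlim_at_bot by blast
  then have bound: "\<forall>\<^sub>F n in sequentially. min_rows q n \<le> q * m n"
    using eventually_ge_at_top[of 2]
  proof eventually_elim
    case (elim n)
    note mn = m[OF elim(2)]
    have X0: "exp 1 * (X n + 1) > 0" using mn by (simp add: add_pos_pos)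
    have "8 * real n ^ 2 * real q ^ 3 * (exp 1 * real (m n)) ^ (3 * q) * D_const q ^ m n
       \<le> 8 * real n ^ 2 * r ^ 3 * (exp 1 * (X n + 1)) ^ (3 * q) * D_const q powr X n"
    proof -
      have "D_const q ^ m n \<le> D_const q powr X n"
        unfolding powr_realpow[OF D(1), symmetric] using mn D by (intro powr_mono') auto
      moreover have "(exp 1 * real (m n)) ^ (3 * q) \<le> (exp 1 * (X n + 1)) ^ (3 * q)"
        using mn by (intro power_mono mult_left_mono) auto
      ultimately show ?thesis
        unfolding r_def using X0 D by (intro mult_mono mult_left_mono) auto
    qed
    also have "\<dots> = exp (2 * ln n) * exp (ln 8 + 3 * ln r + 3 * r * ln (exp 1 * (X n + 1))) * exp (- l * X n)"
    proof -
      have "exp (ln 8 + 3 * ln r + 3 * r * ln (exp 1 * (X n + 1))) = 8 * r ^ 3 * (exp 1 * (X n + 1)) ^ (3 * q)"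
        using r X0 exp_of_nat_mult[of "3 * q" "ln (exp 1 * (X n + 1))"] exp_of_nat_mult[of 3 "ln r"]
        by (simp add: exp_add r_def)
      moreover have "exp (2 * ln n) = real n ^ 2"
        using elim(2) exp_of_nat_mult[of 2 "ln n"] by simp
      moreover have "D_const q powr X n = exp (- l * X n)"
        using D by (simp add: powr_def l_def ln_div)
      ultimately show ?thesis by simp
    qed
    also have "\<dots> = exp (ln 8 + 3 * ln r + 3 * r * ln (exp 1 * (X n + 1)) - l * sqrt (ln n))"
    proof -
      have "l * X n = 2 * ln n + l * sqrt (ln n)" using l by (simp add: X_def field_simps)
      then show ?thesis by (simp flip: exp_add)
    qed
    also have "\<dots> \<le> 1" using elim(1) by simp
    finally show ?case using min_rows_le[OF assms elim(2) mn(3)] by simp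
  qed
  show ?thesis
  proof (intro exI conjI)
    \<comment> \<open>Upper envelope of \<open>\<epsilon>\<close>: the ceiling adds at most 1 to
      \<open>X n\<close>.\<close>
    have lim: "(\<lambda>n::nat. (2 * ln n / l + sqrt (ln n) + 1) * l / (2 * ln n) - 1) \<longlonglongrightarrow> 0"
      using l by real_asymp
    have "\<epsilon> \<longlonglongrightarrow> 0"
    proof (rule tendsto_sandwich[OF _ _ tendsto_const lim])
      show "\<forall>\<^sub>F n in sequentially. 0 \<le> \<epsilon> n"
        using eventually_ge_at_top[of 2]
      proof eventually_elim
        case (elim n)
        have "2 * ln n \<le> X n * l" using elim l by (simp add: X_def field_simps)
        also have "\<dots> \<le> real (m n) * l" using m[OF elim] l by simp
        finally show ?case using elim by (simp add: \<epsilon>_def)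
      qed
      show "\<forall>\<^sub>F n in sequentially. \<epsilon> n \<le> (2 * ln n / l + sqrt (ln n) + 1) * l / (2 * ln n) - 1"
        using eventually_ge_at_top[of 2]
      proof eventually_elim
        case (elim n)
        then show ?case
          unfolding \<epsilon>_def X_def[symmetric] using m[OF elim] l
          by (intro diff_mono divide_right_mono mult_right_mono) auto
      qed
    qed
    then show "\<epsilon> \<in> o(\<lambda>_. 1)" by (intro smalloI_tendsto) simp_all
    show "\<forall>\<^sub>F n in sequentially. real (min_rows q n) \<le> B_const q * log 2 (real n) * (1 + \<epsilon> n)"
      using bound eventually_ge_at_top[of 2]
    proof eventually_elim
      case (elim n)
      have "B_const q * log 2 (real n) * (1 + \<epsilon> n) = real (q * m n)"
        using elim(2) l by (simp add: B_const_def \<epsilon>_def log_def l_def[symmetric])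
      then show ?case using elim(1) by (simp only: of_nat_le_iff)
    qed
  qed
qed

end
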